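(* For every integer $r\ge0$, every integer $n\ge0$, every real $y$ and every real $x$ with $1+\lambda x>0$, \[ B^{(r)}_{n,\lambda}(x,y)=\frac{1}{e_\lambda(x)}(XD+r)_{n,\lambda}\,e^y_\lambda(x), \] where $e_\lambda^y(x)=(1+\lambda x)^{y/\lambda}$ is regarded as a function of $x$.
   Context: Let $\lambda$ be a fixed nonzero real number and $r\ge0$ an integer. The degenerate falling factorial is $(x)_{0,\lambda}=1$ and $(x)_{n,\lambda}=x(x-\lambda)\cdots(x-(n-1)\lambda)$ for $n\ge1$. The degenerate exponential is $e_\lambda^{x}(t)=(1+\lambda t)^{x/\lambda}=\sum_{n\ge0}(x)_{n,\lambda}\frac{t^n}{n!}$, and $e_\lambda(t)=e_\lambda^1(t)$. For real $x,y$ with $1+\lambda x>0$, the two variable fully degenerate $r$-Bell polynomials are defined by the formal power series identity in $t$ \[ \frac{1}{e_\lambda(x)}\,e^y_\lambda\big(xe_\lambda(t)\big)\,e_\lambda^r(t)=\sum_{n\ge0}B^{(r)}_{n,\lambda}(x,y)\frac{t^n}{n!},\qquad e_\lambda^{y}(xe_\lambda(t))=(1+\lambda x e_\lambda(t))^{y/\lambda}. \] On smooth functions of $x$ (on the interval $1+\lambda x>0$), $X$ denotes multiplication by $x$, $D=\frac{d}{dx}$, and $(XD+r)_{n,\lambda}=\prod_{i=0}^{n-1}(XD+r-i\lambda)$ (the identity for $n=0$). *)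

theory Defs
  imports "HOL-Analysis.Analysis"
begin

unbundle no vec_syntax
unbundle fps_syntax

definition dfall :: "real \<Rightarrow> real \<Rightarrow> nat \<Rightarrow> real" where
  "dfall lam x n = (\<Prod>i<n. x - real i * lam)"

text \<open>
  With \<open>\<lambda>\<close> written \<open>lam\<close>, the degenerate exponential \<open>e\<^sub>\<lambda>\<^sup>x(t)\<close>, once as a real function
  (meaningful for \<open>1 + \<lambda> t > 0\<close>) and once as a formal power series in \<open>t\<close>.
\<close>

definition dexp :: "real \<Rightarrow> real \<Rightarrow> real \<Rightarrow> real" where
  "dexp lam x t = (1 + lam * t) powr (x / lam)"

definition dexp_fps :: "real \<Rightarrow> real \<Rightarrow> real fps" where
  "dexp_fps lam x = Abs_fps (\<lambda>n. dfall lam x n / fact n)"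

text \<open>
  Real power \<open>F\<^sup>c\<close> of a formal power series with constant term \<open>F\<^sub>0 > 0\<close>:
  write \<open>F = F\<^sub>0 (1 + u)\<close>, where \<open>u\<close> has constant term 0, and expand \<open>(1 + u)\<^sup>c\<close>
  by the binomial series. The constant term of the result is \<open>F\<^sub>0 powr c\<close>.
\<close>

definition fps_rpowr :: "real fps \<Rightarrow> real \<Rightarrow> real fps" where
  "fps_rpowr F c =
     fps_const ((F $ 0) powr c) * (fps_binomial c oo (fps_const (1 / (F $ 0)) * F - 1))"

lemma fps_rpowr_of_nat:
  assumes "F $ 0 > 0"
  shows "fps_rpowr F (real n) = F ^ n"
proof -
  let ?u = "fps_const (1 / (F $ 0)) * F - 1"
  have u0: "?u $ 0 = 0"
    using assms by simp
  have "fps_binomial (real n) oo ?u = (1 + ?u) ^ n"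
    unfolding fps_binomial_of_nat fps_compose_power[OF u0, symmetric]
    by (simp add: fps_compose_add_distrib fps_X_fps_compose_startby0[OF u0])
  also have "\<dots> = fps_const ((1 / (F $ 0)) ^ n) * F ^ n"
    by (simp add: power_mult_distrib)
  finally show ?thesis
    using assms
    by (simp add: fps_rpowr_def powr_realpow mult.assoc[symmetric] power_divide)
qed

lemma dexp_fps_eq_fps_rpowr:
  assumes "lam \<noteq> 0"
  shows "dexp_fps lam x = fps_rpowr (1 + fps_const lam * fps_X) (x / lam)"
proof (rule fps_ext)
  fix n
  have "dfall lam x n = lam ^ n * (\<Prod>i<n. x / lam - real i)"
    using assms
    by (induction n) (simp_all add: dfall_def field_simps)
  then show "dexp_fps lam x $ n = fps_rpowr (1 + fps_const lam * fps_X) (x / lam) $ n"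
    by (simp add: dexp_fps_def fps_rpowr_def fps_compose_linear gbinomial_prod_rev
        atLeast0LessThan)
qed

text \<open>
  The generating function \<open>e\<^sub>\<lambda>\<^sup>y(x e\<^sub>\<lambda>(t)) e\<^sub>\<lambda>\<^sup>r(t) / e\<^sub>\<lambda>(x)\<close> in \<open>t\<close>; the series
  \<open>1 + \<lambda> x e\<^sub>\<lambda>(t)\<close> has constant term \<open>1 + \<lambda> x\<close>.
\<close>

definition rBell_gf :: "real \<Rightarrow> nat \<Rightarrow> real \<Rightarrow> real \<Rightarrow> real fps" where
  "rBell_gf lam r x y =
     fps_const (1 / dexp lam 1 x)
     * fps_rpowr (1 + fps_const (lam * x) * dexp_fps lam 1) (y / lam)
     * dexp_fps lam (real r)"

definition rBell :: "real \<Rightarrow> nat \<Rightarrow> nat \<Rightarrow> real \<Rightarrow> real \<Rightarrow> real" where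
  "rBell lam r n x y = fact n * rBell_gf lam r x y $ n"

lemma rBell_egf: "rBell_gf lam r x y = Abs_fps (\<lambda>n. rBell lam r n x y / fact n)"
  by (rule fps_ext) (simp add: rBell_def)

text \<open>
  \<open>XD + a\<close> acts pointwise through \<^const>\<open>deriv\<close>, which depends only on the germ of the function;
  hence on the open set \<open>1 + \<lambda> x > 0\<close> the values off that set play no role.
\<close>

definition XD_plus :: "real \<Rightarrow> (real \<Rightarrow> real) \<Rightarrow> real \<Rightarrow> real" where
  "XD_plus a f = (\<lambda>x. x * deriv f x + a * f x)"

text \<open>
  The operator product \<open>(XD + r)(XD + r - \<lambda>) \<dots> (XD + r - (n - 1) \<lambda>)\<close>; the
  rightmost factor is applied first.
\<close>

primrec XD_dfall :: "real \<Rightarrow> real \<Rightarrow> nat \<Rightarrow> (real \<Rightarrow> real) \<Rightarrow> real \<Rightarrow> real" where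
  "XD_dfall lam r 0 = id"
| "XD_dfall lam r (Suc n) = XD_dfall lam r n \<circ> XD_plus (r - real n * lam)"

end

theory Submission
  imports Defs
begin

text \<open>
  Let \<open>\<theta> = (1 + \<lambda>t) d/dt\<close>. The function \<open>u \<mapsto> (1 + \<lambda>u)\<^sup>c\<close> and the series
  \<open>W\<^sup>c\<close> with \<open>W = 1 + \<lambda> x e\<^sub>\<lambda>(t)\<close> generate isomorphic differential modules: with
  \<open>z = u / (1 + \<lambda>u)\<close> and \<open>Z = x e\<^sub>\<lambda>(t) / W\<close>, the operator \<open>XD\<close> sends
  \<open>P(z) (1 + \<lambda>u)\<^sup>c\<close> to \<open>Q(z) (1 + \<lambda>u)\<^sup>c\<close>, and \<open>\<theta>\<close> sends \<open>P(Z) W\<^sup>c\<close> to \<open>Q(Z) W\<^sup>c\<close>,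
  for the same polynomial \<open>Q = z (1 - \<lambda>z) P' + \<lambda>c z P\<close>. Since \<open>\<theta> e\<^sub>\<lambda>\<^sup>r(t) = r e\<^sub>\<lambda>\<^sup>r(t)\<close>
  and the \<open>n\<close>-th coefficient of \<open>\<theta> F\<close> is \<open>(n + 1) F\<^sub>n\<^sub>+\<^sub>1 + n \<lambda> F\<^sub>n\<close>, passing from the
  \<open>n\<close>-th to the \<open>(n + 1)\<close>-st coefficient amounts to applying \<open>XD + r - n\<lambda>\<close>.
\<close>

definition fps_eval_poly :: "'a::comm_ring_1 poly \<Rightarrow> 'a fps \<Rightarrow> 'a fps" where
  "fps_eval_poly P Z = poly (map_poly fps_const P) Z"

lemma fps_eval_poly_0 [simp]: "fps_eval_poly 0 Z = 0"
  by (simp add: fps_eval_poly_def)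

lemma fps_eval_poly_pCons [simp]:
  "fps_eval_poly (pCons a P) Z = fps_const a + Z * fps_eval_poly P Z"
  by (simp add: fps_eval_poly_def map_poly_pCons)

lemma fps_eval_poly_add [simp]:
  "fps_eval_poly (P + Q) Z = fps_eval_poly P Z + fps_eval_poly Q Z"
proof -
  have "map_poly fps_const (P + Q) = map_poly fps_const P + map_poly fps_const Q"
    by (rule poly_eqI) (simp add: coeff_map_poly)
  then show ?thesis
    by (simp add: fps_eval_poly_def)
qed

lemma fps_eval_poly_smult [simp]:
  "fps_eval_poly (smult a P) Z = fps_const a * fps_eval_poly P Z"
  by (induction P) (simp_all add: algebra_simps flip: fps_const_mult)

lemma fps_eval_poly_nth_0 [simp]: "fps_eval_poly P Z $ 0 = poly P (Z $ 0)"
  by (induction P) simp_all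

lemma fps_deriv_fps_eval_poly:
  fixes P :: "'a::idom poly"
  shows "fps_deriv (fps_eval_poly P Z) = fps_eval_poly (pderiv P) Z * fps_deriv Z"
  by (induction P) (simp_all add: pderiv_pCons algebra_simps)

text \<open>Multiplying by \<open>F\<close> keeps the power rule free of division. It comes from the
  equation (1 + X) B' = c B for the binomial series B, composed with \<open>u\<close>, where F = F_0
  (1 + u).\<close>

lemma fps_deriv_fps_rpowr:
  assumes "F $ 0 > 0"
  shows "F * fps_deriv (fps_rpowr F c) = fps_const c * fps_deriv F * fps_rpowr F c"
proof -
  define u where "u = fps_const (1 / (F $ 0)) * F - 1"
  have u0: "u $ 0 = 0"
    using assms by (simp add: u_def)
  have "(1 + fps_X) * fps_deriv (fps_binomial c) = fps_const c * fps_binomial c"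
    using inverse_mult_eq_1'[of "1 + fps_X :: real fps"]
    by (simp add: fps_binomial_deriv fps_divide_unit mult.left_commute[of "1 + fps_X"])
  then have "((1 + fps_X) * fps_deriv (fps_binomial c)) oo u = (fps_const c * fps_binomial c) oo u"
    by simp
  then have *: "(1 + u) * (fps_deriv (fps_binomial c) oo u) = fps_const c * (fps_binomial c oo u)"
    by (simp add: fps_compose_mult_distrib[OF u0] fps_compose_add_distrib
        fps_X_fps_compose_startby0[OF u0])
  have F: "F = fps_const (F $ 0) * (1 + u)"
    using assms by (simp add: u_def flip: mult.assoc)
  have dF: "fps_deriv F = fps_const (F $ 0) * fps_deriv u"
    by (subst F) simp
  have "fps_deriv (fps_rpowr F c) =
      fps_const ((F $ 0) powr c) * ((fps_deriv (fps_binomial c) oo u) * fps_deriv u)"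
    by (simp add: fps_rpowr_def fps_compose_deriv[OF u0] flip: u_def)
  then have "F * fps_deriv (fps_rpowr F c) =
      fps_const (F $ 0) * fps_const ((F $ 0) powr c) * fps_deriv u
        * ((1 + u) * (fps_deriv (fps_binomial c) oo u))"
    by (subst F) (simp only: mult_ac)
  also have "\<dots> = fps_const c * fps_deriv F * fps_rpowr F c"
    by (simp only: * dF fps_rpowr_def flip: u_def) (simp only: mult_ac)
  finally show ?thesis .
qed

lemma fps_rpowr_nth_0: "fps_rpowr F c $ 0 = (F $ 0) powr c"
  by (simp add: fps_rpowr_def)

definition dtheta :: "'a::comm_ring_1 \<Rightarrow> 'a fps \<Rightarrow> 'a fps" where
  "dtheta lam F = (1 + fps_const lam * fps_X) * fps_deriv F"

lemma dtheta_mult: "dtheta lam (F * G) = dtheta lam F * G + F * dtheta lam G"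
  by (simp add: dtheta_def algebra_simps)

lemma dtheta_nth: "dtheta lam F $ n = of_nat (Suc n) * F $ Suc n + lam * of_nat n * F $ n"
  by (cases n) (simp_all add: dtheta_def algebra_simps)

text \<open>In the coefficient recurrence, the extra factor a - n lam of \<open>dfall\<close> loses
  its term n lam to the second summand of \<open>dtheta_nth\<close>.\<close>

lemma dtheta_dexp_fps: "dtheta lam (dexp_fps lam a) = fps_const a * dexp_fps lam a"
proof (rule fps_ext)
  fix n
  have "real (Suc n) * (dfall lam a (Suc n) / fact (Suc n)) = dfall lam a n * (a - real n * lam) / fact n"
    by (simp add: dfall_def del: of_nat_Suc)
  then show "dtheta lam (dexp_fps lam a) $ n = (fps_const a * dexp_fps lam a) $ n"
    by (simp add: dtheta_nth dexp_fps_def field_simps del: of_nat_Suc fact_Suc)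
qed

lemma dexp_fps_nth_0 [simp]: "dexp_fps lam a $ 0 = 1"
  by (simp add: dexp_fps_def dfall_def)

text \<open>The polynomial Q of the overview; the outer \<open>pCons 0\<close> is the common factor
  z.\<close>

definition euler_poly :: "real \<Rightarrow> real \<Rightarrow> real poly \<Rightarrow> real poly" where
  "euler_poly lam c P =
     pCons 0 (pderiv P + smult (- lam) (pCons 0 (pderiv P)) + smult (lam * c) P)"

text \<open>The form P(z) w^c with w = 1 + lam u is assumed only where w > 0 and is reproduced
  there, so the lemma can be iterated. Differentiation is legitimate because this set is
  open.\<close>

lemma XD_plus_poly_powr:
  assumes f: "\<And>u. 1 + lam * u > 0 \<Longrightarrow>
      f u = poly P (u / (1 + lam * u)) * (1 + lam * u) powr c"
    and x: "1 + lam * x > 0"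
  shows "XD_plus a f x =
    poly (euler_poly lam c P + smult a P) (x / (1 + lam * x)) * (1 + lam * x) powr c"
proof -
  let ?w = "1 + lam * x"
  let ?z = "x / ?w"
  define S where "S = {u. 1 + lam * u > 0}"
  have S: "open S" "x \<in> S"
    using x by (auto simp: S_def intro!: open_Collect_less continuous_intros)
  have z: "((\<lambda>u. u / (1 + lam * u)) has_real_derivative 1 / ?w ^ 2) (at x)"
    using x by (auto intro!: derivative_eq_intros simp: power2_eq_square)
  have w: "((\<lambda>u. (1 + lam * u) powr c) has_real_derivative lam * c * (?w powr c / ?w)) (at x)"
    using x by (auto intro!: derivative_eq_intros simp: powr_diff)
  have "((\<lambda>u. poly P (u / (1 + lam * u)) * (1 + lam * u) powr c) has_real_derivative
      poly (pderiv P) ?z * (1 / ?w ^ 2) * ?w powr c + lam * c * (?w powr c / ?w) * poly P ?z) (at x)"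
    by (rule DERIV_mult[OF DERIV_chain2[OF poly_DERIV z] w])
  then have "(f has_real_derivative
      poly (pderiv P) ?z * (1 / ?w ^ 2) * ?w powr c + lam * c * (?w powr c / ?w) * poly P ?z) (at x)"
    by (rule has_field_derivative_transform_within_open[OF _ S]) (simp add: S_def f)
  then have d: "deriv f x =
      poly (pderiv P) ?z * (1 / ?w ^ 2) * ?w powr c + lam * c * (?w powr c / ?w) * poly P ?z"
    by (rule DERIV_imp_deriv)
  \<comment> \<open>This turns x z' = x / w^2 into a polynomial in z.\<close>
  have "1 - lam * ?z = 1 / ?w"
    using x by (simp add: field_simps)
  then have "x / ?w ^ 2 = ?z * (1 - lam * ?z)"
    by (simp add: power2_eq_square)
  then have "x / ?w ^ 2 = ?z - lam * ?z * ?z"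
    by (simp add: algebra_simps)
  moreover have "x * deriv f x =
      (poly (pderiv P) ?z * (x / ?w ^ 2) + lam * c * ?z * poly P ?z) * ?w powr c"
    by (simp add: d algebra_simps)
  ultimately have "x * deriv f x =
      (poly (pderiv P) ?z * (?z - lam * ?z * ?z) + lam * c * ?z * poly P ?z) * ?w powr c"
    by simp
  then show ?thesis
    by (simp add: XD_plus_def f[OF x] euler_poly_def algebra_simps)
qed

definition dtwist :: "real \<Rightarrow> real \<Rightarrow> real fps" where
  "dtwist lam x = 1 + fps_const (lam * x) * dexp_fps lam 1"

lemma dtwist_nth_0 [simp]: "dtwist lam x $ 0 = 1 + lam * x"
  by (simp add: dtwist_def)

definition dratio :: "real \<Rightarrow> real \<Rightarrow> real fps" where
  "dratio lam x = fps_const x * dexp_fps lam 1 * inverse (dtwist lam x)"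

lemma dratio_nth_0 [simp]: "dratio lam x $ 0 = x / (1 + lam * x)"
  by (simp add: dratio_def field_simps)

lemma dratio_dtwist:
  assumes "1 + lam * x \<noteq> 0"
  shows "dratio lam x * dtwist lam x = fps_const x * dexp_fps lam 1"
  using assms by (simp add: dratio_def inverse_mult_eq_1 mult.assoc)

lemma dtheta_dtwist:
  assumes "1 + lam * x \<noteq> 0"
  shows "dtheta lam (dtwist lam x) = fps_const lam * dratio lam x * dtwist lam x"
proof -
  have "dtheta lam (dtwist lam x) = fps_const (lam * x) * dtheta lam (dexp_fps lam 1)"
    by (simp add: dtheta_def dtwist_def mult_ac)
  then show ?thesis
    by (simp add: dtheta_dexp_fps dratio_dtwist[OF assms] mult.assoc flip: fps_const_mult)
qed

text \<open>The product Z W = x e(t) is fixed by \<theta>. The product rule and cancellation of W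
  then give \<theta> Z without differentiating an inverse.\<close>

lemma dtheta_dratio:
  assumes "1 + lam * x \<noteq> 0"
  shows "dtheta lam (dratio lam x) = dratio lam x - fps_const lam * dratio lam x * dratio lam x"
proof -
  let ?Z = "dratio lam x" and ?W = "dtwist lam x"
  have W: "?W \<noteq> 0"
    using assms by (metis dtwist_nth_0 fps_zero_nth)
  have "dtheta lam (?Z * ?W) = fps_const x * dtheta lam (dexp_fps lam 1)"
    unfolding dratio_dtwist[OF assms] by (simp add: dtheta_def mult_ac)
  also have "\<dots> = ?Z * ?W"
    by (simp add: dtheta_dexp_fps dratio_dtwist[OF assms])
  finally have "dtheta lam ?Z * ?W = (?Z - fps_const lam * ?Z * ?Z) * ?W"
    by (simp add: dtheta_mult dtheta_dtwist[OF assms] algebra_simps)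
  then show ?thesis
    using W by simp
qed

text \<open>For 1 + lam x > 0, the constant coefficient in t is P(z) (1 + lam x)^c with z = x / (1 +
  lam x), which is the function that XD acts on.\<close>

definition eval_gf :: "real \<Rightarrow> real \<Rightarrow> real \<Rightarrow> real poly \<Rightarrow> real \<Rightarrow> real fps" where
  "eval_gf lam c r P x =
     fps_eval_poly P (dratio lam x) * fps_rpowr (dtwist lam x) c * dexp_fps lam r"

lemma dtheta_eval_gf:
  assumes "1 + lam * x > 0"
  shows "dtheta lam (eval_gf lam c r P x) = eval_gf lam c r (euler_poly lam c P + smult r P) x"
proof -
  let ?Z = "dratio lam x" and ?W = "dtwist lam x"
  have x: "1 + lam * x \<noteq> 0" and W: "?W \<noteq> 0"
    using assms dtwist_nth_0[of lam x] by (auto simp del: dtwist_nth_0)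
  \<comment> \<open>The factor W makes the division-free power rule applicable; it cancels at the
    end because W is nonzero.\<close>
  have "?W * dtheta lam (fps_rpowr ?W c) =
      (1 + fps_const lam * fps_X) * (?W * fps_deriv (fps_rpowr ?W c))"
    by (simp only: dtheta_def mult_ac)
  also have "\<dots> = fps_const c * dtheta lam ?W * fps_rpowr ?W c"
    using assms by (subst fps_deriv_fps_rpowr) (simp_all only: dtwist_nth_0 dtheta_def mult_ac)
  also have "\<dots> = ?W * (fps_const (lam * c) * ?Z * fps_rpowr ?W c)"
    by (simp add: dtheta_dtwist[OF x] mult_ac flip: fps_const_mult)
  finally have pw: "dtheta lam (fps_rpowr ?W c) = fps_const (lam * c) * ?Z * fps_rpowr ?W c"
    using W by simp
  have pl: "dtheta lam (fps_eval_poly P ?Z) = fps_eval_poly (pderiv P) ?Z * dtheta lam ?Z"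
    by (simp only: dtheta_def fps_deriv_fps_eval_poly mult_ac)
  show ?thesis
    by (simp add: eval_gf_def dtheta_mult pw pl dtheta_dexp_fps dtheta_dratio[OF x]
        euler_poly_def algebra_simps del: smult_minus_left flip: fps_const_mult fps_const_neg)
qed

lemma eval_gf_smult: "eval_gf lam c r (P + smult a Q) x = eval_gf lam c r P x + fps_const a * eval_gf lam c r Q x"
  by (simp add: eval_gf_def algebra_simps)

text \<open>\<open>XD_dfall\<close> applies its last factor r - n lam directly to f, so the
  induction must vary f and P: the hypothesis is used for the image of f and its new
  polynomial.\<close>

lemma XD_dfall_eq_eval_gf_nth:
  assumes "\<And>u. 1 + lam * u > 0 \<Longrightarrow>
      f u = poly P (u / (1 + lam * u)) * (1 + lam * u) powr c"
    and x: "1 + lam * x > 0"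
  shows "XD_dfall lam r n f x = fact n * eval_gf lam c r P x $ n"
  using assms(1)
proof (induction n arbitrary: f P)
  case 0
  then show ?case
    using x by (simp add: eval_gf_def fps_rpowr_nth_0)
next
  case (Suc n)
  let ?Q = "euler_poly lam c P" and ?a = "r - real n * lam"
  have "XD_dfall lam r (Suc n) f x = fact n * eval_gf lam c r (?Q + smult ?a P) x $ n"
    using Suc.IH[OF XD_plus_poly_powr[OF Suc.prems]] by simp
  also have "eval_gf lam c r (?Q + smult ?a P) x =
      dtheta lam (eval_gf lam c r P x) - fps_const (real n * lam) * eval_gf lam c r P x"
    by (simp only: dtheta_eval_gf[OF x] eval_gf_smult)
       (simp add: algebra_simps flip: fps_const_sub)
  \<comment> \<open>The shift by -n lam cancels the lower coefficient in \<open>dtheta_nth\<close>;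
    the remaining factor n + 1 completes the factorial.\<close>
  also have "\<dots> $ n = real (Suc n) * eval_gf lam c r P x $ Suc n"
    by (simp add: dtheta_nth)
  finally show ?case
    by simp
qed

theorem theorem2p14:
  fixes lam x y :: real and r n :: nat
  assumes "lam \<noteq> 0" and "1 + lam * x > 0"
  shows "rBell lam r n x y = 1 / dexp lam 1 x * XD_dfall lam (real r) n (\<lambda>u. dexp lam y u) x"
proof -
  \<comment> \<open>The starting function is the case P = 1, c = y / lam.\<close>
  have "XD_dfall lam (real r) n (\<lambda>u. dexp lam y u) x = fact n * eval_gf lam (y / lam) (real r) 1 x $ n"
    using assms(2) by (intro XD_dfall_eq_eval_gf_nth) (simp_all add: dexp_def)
  moreover have "rBell_gf lam r x y = fps_const (1 / dexp lam 1 x) * eval_gf lam (y / lam) (real r) 1 x"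
    by (simp add: rBell_gf_def eval_gf_def dtwist_def one_pCons mult.assoc)
  ultimately show ?thesis
    by (simp add: rBell_def)
qed

end
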